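(* Let $G$ be a locally compact Abelian group and let $f\in AP(G)$ be an almost periodic function. Then: (i) For any given Følner sequence $(F_n)$ in $G$, the following limit exists for every $g\in G$, is independent of $g$, and equals the Bohr mean of $f$: $$\forall g\in G,\qquad \mathcal{M}(f)=\lim_{n\to\infty}\frac{1}{|F_n|}\int_{F_n}f(x+g)\,dx.$$ (ii) The limit in (i) is independent of the choice of the Følner sequence. (iii) The limit in (i) is uniform in $g\in G$.
   Context: $G$ is written additively, $dx$ is a Haar measure on $G$ and $|F|$ is the Haar measure of $F\subset G$. $AP(G)$ is the space of complex-valued almost periodic functions on $G$ in the sense of Bohr, i.e. bounded continuous functions $f$ whose set of translates $\{f(\cdot+g):g\in G\}$ is relatively compact for the supremum norm (equivalently, uniform limits of finite linear combinations of continuous characters of $G$). The Bohr mean $\mathcal{M}:AP(G)\to\mathbb{C}$ is the unique continuous translation-invariant linear functional with $\mathcal{M}(1)=1$. A Følner sequence in $G$ is an increasing sequence of compact subsets $(F_n)$ of $G$ (with $|F_n|>0$) such that $|F_n\,\Delta\,(F_n+a)|/|F_n|\to0$ as $n\to\infty$ for every $a\in G$. *)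

theory Defs
  imports "HOL-Analysis.Analysis"
begin

text \<open>
  The group \<open>G\<close> is the whole of a type of class \<open>topological_ab_group_add\<close>. Following the usual
  convention, locally compact Abelian groups are Hausdorff (class \<open>t2_space\<close>); no countability
  or metrizability is assumed.
\<close>

text \<open>
  A Haar measure is a nonzero translation-invariant Radon measure on the Borel sets.
  The group need not be \<open>\<sigma>\<close>-compact, so inner regularity is required on open sets only.
\<close>

definition haar_measure :: "'a::{topological_ab_group_add, t2_space} measure \<Rightarrow> bool" where
  "haar_measure \<mu> \<longleftrightarrow>
     sets \<mu> = sets borel \<and>
     emeasure \<mu> UNIV \<noteq> 0 \<and>
     (\<forall>K. compact K \<longrightarrow> emeasure \<mu> K < \<infinity>) \<and>
     (\<forall>A \<in> sets borel. emeasure \<mu> A = (INF U\<in>{U. open U \<and> A \<subseteq> U}. emeasure \<mu> U)) \<and>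
     (\<forall>U. open U \<longrightarrow> emeasure \<mu> U = (SUP K\<in>{K. compact K \<and> K \<subseteq> U}. emeasure \<mu> K)) \<and>
     (\<forall>a. \<forall>A \<in> sets borel. emeasure \<mu> ((\<lambda>x. x + a) ` A) = emeasure \<mu> A)"

definition folner_seq ::
    "'a::{topological_ab_group_add, t2_space} measure \<Rightarrow> (nat \<Rightarrow> 'a set) \<Rightarrow> bool" where
  "folner_seq \<mu> F \<longleftrightarrow>
     incseq F \<and>
     (\<forall>n. compact (F n) \<and> measure \<mu> (F n) > 0) \<and>
     (\<forall>a. (\<lambda>n. measure \<mu> (sym_diff (F n) ((\<lambda>x. x + a) ` F n)) / measure \<mu> (F n))
            \<longlonglongrightarrow> 0)"

text \<open>
  The type \<open>'a \<Rightarrow>\<^sub>C complex\<close> consists of the bounded continuous functions, with the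
  supremum metric.
\<close>

definition translate ::
    "'a::topological_ab_group_add \<Rightarrow> ('a \<Rightarrow>\<^sub>C complex) \<Rightarrow> ('a \<Rightarrow>\<^sub>C complex)" where
  "translate g f = Bcontfun (\<lambda>x. apply_bcontfun f (x + g))"

lemma apply_translate [simp]: "apply_bcontfun (translate g f) x = apply_bcontfun f (x + g)"
proof -
  have "continuous_on UNIV (\<lambda>x. apply_bcontfun f (x + g))"
    by (rule continuous_on_compose2[where g = "apply_bcontfun f" and t = UNIV])
      (auto intro!: continuous_intros)
  moreover have "bounded (range (\<lambda>x. apply_bcontfun f (x + g)))"
    by (rule bounded_subset[OF bounded_apply_bcontfun[of f]]) auto
  ultimately show ?thesis
    by (simp add: translate_def bcontfun_def Bcontfun_inverse)
qed

text \<open>The library provides only the real vector space structure on this type.\<close>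

definition cscale ::
    "complex \<Rightarrow> ('a::topological_space \<Rightarrow>\<^sub>C complex) \<Rightarrow> ('a \<Rightarrow>\<^sub>C complex)" where
  "cscale c f = Bcontfun (\<lambda>x. c * apply_bcontfun f x)"

lemma apply_cscale [simp]: "apply_bcontfun (cscale c f) x = c * apply_bcontfun f x"
proof -
  have "continuous_on UNIV (\<lambda>x. c * apply_bcontfun f x)"
    by (intro continuous_intros) auto
  moreover have "bounded (range (\<lambda>x. c * apply_bcontfun f x))"
    using bounded_linear_image[OF bounded_apply_bcontfun[of f] bounded_linear_mult_right[of c]]
    by (simp add: image_image)
  ultimately show ?thesis
    by (simp add: cscale_def bcontfun_def Bcontfun_inverse)
qed

definition AP :: "('a::topological_ab_group_add \<Rightarrow>\<^sub>C complex) set" where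
  "AP = {f. compact (closure (range (\<lambda>g. translate g f)))}"

text \<open>
  Functionals on \<open>AP\<close> are represented by functions on the whole type that have the
  fixed value \<open>undefined\<close> outside \<open>AP\<close>, so that uniqueness is meaningful.
\<close>

definition is_bohr_mean ::
    "(('a::topological_ab_group_add \<Rightarrow>\<^sub>C complex) \<Rightarrow> complex) \<Rightarrow> bool" where
  "is_bohr_mean M \<longleftrightarrow>
     M \<in> extensional AP \<and>
     (\<forall>f\<in>AP. \<forall>h\<in>AP. M (f + h) = M f + M h) \<and>
     (\<forall>c. \<forall>f\<in>AP. M (cscale c f) = c * M f) \<and>
     continuous_on AP M \<and>
     (\<forall>g. \<forall>f\<in>AP. M (translate g f) = M f) \<and>
     M (const_bcontfun 1) = 1"

definition bohr_mean :: "('a::topological_ab_group_add \<Rightarrow>\<^sub>C complex) \<Rightarrow> complex" where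
  "bohr_mean = (THE M. is_bohr_mean M)"

definition folner_average ::
    "'a::topological_ab_group_add measure \<Rightarrow> 'a set \<Rightarrow> ('a \<Rightarrow>\<^sub>C complex) \<Rightarrow> 'a \<Rightarrow> complex" where
  "folner_average \<mu> A f g =
     (1 / complex_of_real (measure \<mu> A)) * (LINT x:A|\<mu>. apply_bcontfun f (x + g))"

end

theory Submission
  imports Defs
begin

text \<open>
  Say that \<open>f\<close> averages to the constant \<open>c\<close> within \<open>e\<close> if some finite convex combination of
  translates of \<open>f\<close> is uniformly within \<open>e\<close> of \<open>c\<close>. Combining two such combinations
  (translates commute) shows that two constants to which \<open>f\<close> averages within \<open>e\<close> and \<open>e'\<close> differ
  by at most \<open>e + e'\<close> (\<open>averages_to_unique\<close>). This comparison replaces any use of Fubini's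
  theorem.

  Let \<open>A\<^sub>n f\<close> be the averages along a Foelner sequence. The translates of an almost periodic
  \<open>f\<close> are totally bounded. Cutting \<open>F\<^sub>n\<close> into Borel pieces on which \<open>f(\<cdot> + x)\<close> varies little
  with \<open>x\<close> shows that \<open>A\<^sub>n f\<close> is a uniform limit of convex combinations of translates of \<open>f\<close>
  (\<open>folner_average_convex_approx\<close>). Asymptotic invariance makes \<open>A\<^sub>n f (g)\<close> and \<open>A\<^sub>n f (0)\<close> close
  for each \<open>g\<close>, and total boundedness makes this uniform in \<open>g\<close>
  (\<open>folner_average_nearly_constant\<close>). Hence \<open>f\<close> averages to \<open>A\<^sub>n f (0)\<close> within any given \<open>e\<close> for
  large \<open>n\<close>. By the comparison above these constants form a Cauchy sequence, and their limit \<open>c\<close> is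
  the same for all Foelner sequences; the convergence is uniform in \<open>g\<close>
  (\<open>ex_averages_to\<close>, \<open>folner_average_uniform_limit\<close>).

  A Bohr mean takes the same value at \<open>f\<close> and at each convex combination of its translates; by
  continuity this value is \<open>c\<close>. Conversely, the limit along one Foelner sequence satisfies all
  requirements for a Bohr mean, so the Bohr mean exists, is unique, and has value \<open>c\<close> at \<open>f\<close>
  (\<open>bohr_mean_eq\<close>).
\<close>

section \<open>Convex combinations of translates\<close>

text \<open>
  The function \<open>f\<close> averages to \<open>c\<close> within \<open>e\<close> if a convex combination of its translates is
  uniformly within \<open>e\<close> of \<open>c\<close>. The combination is a family indexed by an initial segment of the
  naturals, so that translates may be repeated.
\<close>

definition averages_to :: "('a::ab_group_add \<Rightarrow> complex) \<Rightarrow> complex \<Rightarrow> real \<Rightarrow> bool" where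
  "averages_to f c e \<longleftrightarrow>
     (\<exists>(k::nat) w a. (\<forall>i<k. 0 \<le> w i) \<and> (\<Sum>i<k. w i) = (1::real) \<and>
        (\<forall>y. cmod ((\<Sum>i<k. complex_of_real (w i) * f (y + a i)) - c) \<le> e))"

lemma convex_combination_dist_le:
  fixes z :: "nat \<Rightarrow> complex"
  assumes "\<forall>i<k. 0 \<le> w i" "(\<Sum>i<k. w i) = (1::real)" "\<And>i. i < k \<Longrightarrow> cmod (z i - c) \<le> e"
  shows "cmod ((\<Sum>i<k. complex_of_real (w i) * z i) - c) \<le> e"
proof -
  have "(\<Sum>i<k. complex_of_real (w i)) = 1"
    using assms(2) by (metis of_real_1 of_real_sum)
  then have "(\<Sum>i<k. complex_of_real (w i) * z i) - c = (\<Sum>i<k. complex_of_real (w i) * (z i - c))"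
    by (simp add: right_diff_distrib sum_subtractf flip: sum_distrib_right)
  also have "cmod \<dots> \<le> (\<Sum>i<k. w i * e)"
    using assms(1,3) by (intro sum_norm_le) (auto simp: norm_mult intro: mult_left_mono)
  also have "\<dots> = e"
    using assms(2) by (simp flip: sum_distrib_right)
  finally show ?thesis .
qed

lemma averages_to_unique:
  assumes "averages_to f c e" "averages_to f c' e'"
  shows "cmod (c - c') \<le> e + e'"
proof -
  obtain k w a where 1: "\<forall>i<k. 0 \<le> w i" "(\<Sum>i<(k::nat). w i) = (1::real)"
    "\<And>y. cmod ((\<Sum>i<k. complex_of_real (w i) * f (y + a i)) - c) \<le> e"
    using assms(1) unfolding averages_to_def by blast
  obtain l v b where 2: "\<forall>i<l. 0 \<le> v i" "(\<Sum>i<(l::nat). v i) = (1::real)"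
    "\<And>y. cmod ((\<Sum>i<l. complex_of_real (v i) * f (y + b i)) - c') \<le> e'"
    using assms(2) unfolding averages_to_def by blast
  \<comment> \<open>the value at 0 of the composed combination, which is near \<open>c'\<close> when the inner sum is over
    the second family and near \<open>c\<close> when the order of summation is exchanged\<close>
  define P where "P = (\<Sum>i<k. complex_of_real (w i) * (\<Sum>j<l. complex_of_real (v j) * f (a i + b j)))"
  have "P = (\<Sum>i<k. \<Sum>j<l. complex_of_real (v j) * (complex_of_real (w i) * f (b j + a i)))"
    unfolding P_def by (simp add: sum_distrib_left ac_simps)
  also have "\<dots> = (\<Sum>j<l. complex_of_real (v j) * (\<Sum>i<k. complex_of_real (w i) * f (b j + a i)))"
    by (subst sum.swap) (simp add: sum_distrib_left)
  finally have P': "P = \<dots>" .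
  have "cmod (P - c') \<le> e'"
    unfolding P_def by (rule convex_combination_dist_le[OF 1(1,2) 2(3)])
  moreover have "cmod (P - c) \<le> e"
    unfolding P' by (rule convex_combination_dist_le[OF 2(1,2) 1(3)])
  ultimately show ?thesis
    using norm_diff_triangle_le[of c P e c' e'] by (simp add: norm_minus_commute)
qed

section \<open>The space of almost periodic functions\<close>

lemma AP_if_subset_compact:
  assumes "compact K" "range (\<lambda>g. translate g f) \<subseteq> K"
  shows "f \<in> AP"
proof -
  have "closure (range (\<lambda>g. translate g f)) \<subseteq> K"
    using assms by (simp add: closure_minimal compact_imp_closed)
  then have "closure (range (\<lambda>g. translate g f)) = K \<inter> closure (range (\<lambda>g. translate g f))"
    by blast
  then show ?thesis
    using compact_Int_closed[OF assms(1) closed_closure] by (metis AP_def mem_Collect_eq)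
qed

lemma AP_add:
  assumes "f \<in> AP" "h \<in> AP"
  shows "f + h \<in> AP"
proof -
  let ?S = "closure (range (\<lambda>g. translate g f))" and ?T = "closure (range (\<lambda>g. translate g h))"
  have "compact {x + y |x y. x \<in> ?S \<and> y \<in> ?T}"
    using assms by (intro compact_sums) (auto simp: AP_def)
  moreover have "translate g (f + h) \<in> {x + y |x y. x \<in> ?S \<and> y \<in> ?T}" for g
  proof -
    have "translate g (f + h) = translate g f + translate g h"
      by (rule bcontfun_eqI) simp
    moreover have "translate g f \<in> ?S" "translate g h \<in> ?T"
      by (meson closure_subset rangeI subsetD)+
    ultimately show ?thesis by blast
  qed
  ultimately show ?thesis
    using AP_if_subset_compact by blast
qed

lemma continuous_on_cscale: "continuous_on S (cscale c)"
proof -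
  have "dist (cscale c f) (cscale c h) \<le> cmod c * dist f h" for f h :: "'a \<Rightarrow>\<^sub>C complex"
  proof (rule dist_bound)
    fix x
    show "dist (cscale c f x) (cscale c h x) \<le> cmod c * dist f h"
      using dist_bounded[of f x h]
      by (simp add: dist_norm mult_left_mono norm_mult flip: right_diff_distrib)
  qed
  then have "(cmod c)-lipschitz_on S (cscale c)"
    by (intro lipschitz_onI) auto
  then show ?thesis
    by (rule lipschitz_on_continuous_on)
qed

lemma AP_cscale:
  assumes "f \<in> AP"
  shows "cscale c f \<in> AP"
proof (rule AP_if_subset_compact)
  show "compact (cscale c ` closure (range (\<lambda>g. translate g f)))"
    using assms by (intro compact_continuous_image continuous_on_cscale) (auto simp: AP_def)
  have "translate g (cscale c f) = cscale c (translate g f)" for g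
    by (rule bcontfun_eqI) simp
  then show "range (\<lambda>g. translate g (cscale c f)) \<subseteq> cscale c ` closure (range (\<lambda>g. translate g f))"
    using closure_subset by fastforce
qed

lemma AP_translate:
  assumes "f \<in> AP"
  shows "translate a f \<in> AP"
proof (rule AP_if_subset_compact)
  show "compact (closure (range (\<lambda>g. translate g f)))"
    using assms by (auto simp: AP_def)
  have "translate g (translate a f) = translate (g + a) f" for g
    by (rule bcontfun_eqI) (simp add: ac_simps)
  then show "range (\<lambda>g. translate g (translate a f)) \<subseteq> closure (range (\<lambda>g. translate g f))"
    using closure_subset by fastforce
qed

lemma AP_const: "const_bcontfun c \<in> AP"
proof (rule AP_if_subset_compact)
  show "compact {const_bcontfun c}"
    by simp
  show "range (\<lambda>g. translate g (const_bcontfun c)) \<subseteq> {const_bcontfun c}"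
    by (auto intro!: bcontfun_eqI)
qed

lemma AP_sum:
  assumes "\<And>i. i \<in> I \<Longrightarrow> h i \<in> AP"
  shows "(\<Sum>i\<in>I. h i) \<in> AP"
  using assms
proof (induction I rule: infinite_finite_induct)
  case (insert i I)
  then show ?case by (auto intro: AP_add)
qed (use AP_const[of 0] in auto)

lemma AP_totally_bounded:
  assumes "f \<in> AP" "0 < e"
  obtains S where "finite S"
    "\<And>g. \<exists>s\<in>S. \<forall>y. cmod (apply_bcontfun f (y + g) - apply_bcontfun f (y + s)) \<le> e"
proof -
  let ?R = "range (\<lambda>g. translate g f)"
  have "closure ?R \<subseteq> (\<Union>g\<in>UNIV. ball (translate g f) e)"
    using \<open>0 < e\<close> by (auto simp: closure_approachable)
  then obtain S where S: "finite S" "closure ?R \<subseteq> (\<Union>g\<in>S. ball (translate g f) e)"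
    using assms(1) compactE_image[of "closure ?R" UNIV "\<lambda>g. ball (translate g f) e"]
    unfolding AP_def by (metis mem_Collect_eq open_ball)
  have "\<exists>s\<in>S. \<forall>y. cmod (f (y + g) - f (y + s)) \<le> e" for g
  proof -
    have "translate g f \<in> closure ?R"
      by (meson closure_subset rangeI subsetD)
    then obtain s where s: "s \<in> S" "dist (translate s f) (translate g f) < e"
      using S(2) by auto
    have "cmod (f (y + g) - f (y + s)) \<le> e" for y
      using dist_fun_lt_imp_dist_val_lt[OF s(2), of y] by (simp add: dist_norm norm_minus_commute)
    then show ?thesis using s(1) by blast
  qed
  then show ?thesis using S(1) that by blast
qed

section \<open>Haar integrals of bounded continuous functions\<close>

lemma haar_measure_sets: "haar_measure \<mu> \<Longrightarrow> sets \<mu> = sets borel"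
  unfolding haar_measure_def by (rule conjunct1)

lemma haar_measure_compact: "haar_measure \<mu> \<Longrightarrow> compact K \<Longrightarrow> emeasure \<mu> K < \<infinity>"
  unfolding haar_measure_def by (elim conjE) iprover

lemma haar_measure_translate:
  "haar_measure \<mu> \<Longrightarrow> A \<in> sets borel \<Longrightarrow> emeasure \<mu> ((\<lambda>x. x + a) ` A) = emeasure \<mu> A"
  unfolding haar_measure_def by (elim conjE) (drule spec, erule bspec)

lemma haar_measure_measurable:
  "haar_measure \<mu> \<Longrightarrow> f \<in> measurable borel N \<Longrightarrow> f \<in> measurable \<mu> N"
  by (simp add: measurable_cong_sets[OF haar_measure_sets refl])

lemma haar_measure_measurable_translate:
  assumes "haar_measure \<mu>"
  shows "(\<lambda>x. x + a) \<in> measurable \<mu> \<mu>"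
proof -
  have "(\<lambda>x. x + a) \<in> borel_measurable borel"
    by (intro borel_measurable_continuous_onI continuous_intros)
  then show ?thesis
    by (simp add: measurable_cong_sets[OF haar_measure_sets haar_measure_sets] assms)
qed

lemma norm_bcontfun_bound: "norm (apply_bcontfun f x) \<le> norm f"
  using dist_bounded[of f x 0] by simp

lemma set_integrable_bcontfun:
  fixes \<phi> :: "'a::{topological_ab_group_add, t2_space} \<Rightarrow>\<^sub>C complex"
  assumes "haar_measure \<mu>" "A \<in> sets borel" "emeasure \<mu> A < \<infinity>"
  shows "set_integrable \<mu> A \<phi>"
proof -
  have "apply_bcontfun \<phi> \<in> borel_measurable \<mu>"
    by (rule haar_measure_measurable[OF assms(1) borel_measurable_continuous_onI]) simp
  then show ?thesis
    unfolding set_integrable_def using assms(2,3)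
    by (intro integrableI_bounded_set_indicator[where B = "norm \<phi>"])
      (simp_all add: haar_measure_sets[OF assms(1)] norm_bcontfun_bound)
qed

lemma norm_integral_le_integral:
  fixes f :: "'a \<Rightarrow> complex"
  assumes "integrable M f" "integrable M g" "\<And>x. cmod (f x) \<le> g x"
  shows "cmod (LINT x|M. f x) \<le> (LINT x|M. g x)"
proof -
  have "(LINT x|M. cmod (f x)) \<le> (LINT x|M. g x)"
    using assms by (intro integral_mono integrable_norm)
  then show ?thesis
    using integral_norm_bound[of M f] by (rule order_trans[rotated])
qed

lemma set_integral_norm_le_measure:
  fixes \<phi> :: "'a \<Rightarrow> complex"
  assumes "A \<in> sets \<mu>" "emeasure \<mu> A < \<infinity>" "set_integrable \<mu> A \<phi>"
    and "\<And>x. x \<in> A \<Longrightarrow> cmod (\<phi> x) \<le> B"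
  shows "cmod (LINT x:A|\<mu>. \<phi> x) \<le> B * measure \<mu> A"
proof -
  have "cmod (LINT x:A|\<mu>. \<phi> x) \<le> (LINT x|\<mu>. B * indicator A x)"
    unfolding set_lebesgue_integral_def
  proof (rule norm_integral_le_integral)
    show "integrable \<mu> (\<lambda>x. indicator A x *\<^sub>R \<phi> x)"
      using assms(3) by (simp add: set_integrable_def)
    show "integrable \<mu> (\<lambda>x. B * indicator A x)"
      using assms(1,2) by simp
    show "cmod (indicator A x *\<^sub>R \<phi> x) \<le> B * indicator A x" for x
      using assms(4) by (auto simp: indicator_def)
  qed
  also have "\<dots> = B * measure \<mu> A"
    using assms(1) by (simp add: Int_absorb2 sets.sets_into_space)
  finally show ?thesis .
qed

lemma sets_borel_translate:
  fixes A :: "'a::{topological_ab_group_add, t2_space} set"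
  assumes "A \<in> sets borel"
  shows "(\<lambda>x. x + a) ` A \<in> sets borel"
proof -
  have "(\<lambda>x. x + a) ` A = (\<lambda>x. x - a) -` A"
    by (force simp: image_iff)
  moreover have "(\<lambda>x. x - a) \<in> borel_measurable borel"
    by (intro borel_measurable_continuous_onI continuous_intros)
  ultimately show ?thesis
    using measurable_sets[of "\<lambda>x. x - a" borel borel A] assms by simp
qed

lemma haar_measure_distr:
  assumes "haar_measure \<mu>"
  shows "distr \<mu> \<mu> (\<lambda>x. x + a) = \<mu>"
proof (rule measure_eqI)
  note sets = haar_measure_sets[OF assms]
  fix A assume "A \<in> sets (distr \<mu> \<mu> (\<lambda>x. x + a))"
  then have A: "A \<in> sets borel" by (simp add: sets)
  have space: "space \<mu> = UNIV"
    using sets_eq_imp_space_eq[OF sets] by simp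
  have meas: "(\<lambda>x. x + a) \<in> measurable \<mu> \<mu>"
    by (rule haar_measure_measurable_translate) fact
  have "emeasure (distr \<mu> \<mu> (\<lambda>x. x + a)) A = emeasure \<mu> ((\<lambda>x. x + a) -` A)"
    using A meas by (simp add: emeasure_distr sets space)
  also have "(\<lambda>x. x + a) -` A = (\<lambda>x. x + (- a)) ` A"
    by (force simp: image_iff)
  also have "emeasure \<mu> \<dots> = emeasure \<mu> A"
    using haar_measure_translate[OF assms A] .
  finally show "emeasure (distr \<mu> \<mu> (\<lambda>x. x + a)) A = emeasure \<mu> A" .
qed simp

lemma set_integral_translate:
  fixes \<phi> :: "'a::{topological_ab_group_add, t2_space} \<Rightarrow>\<^sub>C complex"
  assumes "haar_measure \<mu>" "A \<in> sets borel"
  shows "(LINT x:A|\<mu>. \<phi> (x + a)) = (LINT x:(\<lambda>x. x + a) ` A|\<mu>. \<phi> x)"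
proof -
  let ?h = "\<lambda>x. indicator ((\<lambda>x. x + a) ` A) x *\<^sub>R \<phi> x"
  have meas: "(\<lambda>x. x + a) \<in> measurable \<mu> \<mu>"
    by (rule haar_measure_measurable_translate) fact
  have [measurable]: "apply_bcontfun \<phi> \<in> borel_measurable borel"
    by (intro borel_measurable_continuous_onI) simp
  have [measurable]: "(\<lambda>x. x + a) ` A \<in> sets borel"
    using assms(2) by (rule sets_borel_translate)
  have "?h \<in> borel_measurable borel"
    by measurable
  then have h: "?h \<in> borel_measurable \<mu>"
    by (rule haar_measure_measurable[OF assms(1)])
  have "integral\<^sup>L \<mu> ?h = (LINT x|\<mu>. ?h (x + a))"
    using integral_distr[OF meas h] unfolding haar_measure_distr[OF assms(1)] .
  moreover have "?h (x + a) = indicator A x *\<^sub>R \<phi> (x + a)" for x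
    by (auto simp: indicator_def)
  ultimately show ?thesis
    by (simp add: set_lebesgue_integral_def)
qed

lemma set_integral_diff_le_sym_diff:
  fixes \<phi> :: "'a::{topological_ab_group_add, t2_space} \<Rightarrow>\<^sub>C complex"
  assumes "haar_measure \<mu>" "A \<in> sets borel" "B \<in> sets borel"
    and "emeasure \<mu> A < \<infinity>" "emeasure \<mu> B < \<infinity>"
  shows "cmod ((LINT x:A|\<mu>. \<phi> x) - (LINT x:B|\<mu>. \<phi> x)) \<le> norm \<phi> * measure \<mu> (sym_diff A B)"
proof -
  note sets = haar_measure_sets[OF assms(1)]
  have int: "integrable \<mu> (\<lambda>x. indicator A x *\<^sub>R \<phi> x)" "integrable \<mu> (\<lambda>x. indicator B x *\<^sub>R \<phi> x)"
    using set_integrable_bcontfun[OF assms(1)] assms(2-5) by (auto simp: set_integrable_def)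
  have D: "sym_diff A B \<in> sets \<mu>"
    using assms(2,3) by (auto simp: sets)
  have "emeasure \<mu> (sym_diff A B) \<le> emeasure \<mu> (A \<union> B)"
    using assms(2,3) by (intro emeasure_mono) (auto simp: sets)
  also have "\<dots> \<le> emeasure \<mu> A + emeasure \<mu> B"
    using assms(2,3) by (intro emeasure_subadditive) (auto simp: sets)
  also have "\<dots> < \<infinity>"
    using assms(4,5) by simp
  finally have fin: "emeasure \<mu> (sym_diff A B) < \<infinity>" .
  have "(LINT x:A|\<mu>. \<phi> x) - (LINT x:B|\<mu>. \<phi> x) =
      (LINT x|\<mu>. indicator A x *\<^sub>R \<phi> x - indicator B x *\<^sub>R \<phi> x)"
    unfolding set_lebesgue_integral_def by (rule Bochner_Integration.integral_diff[OF int, symmetric])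
  also have "cmod \<dots> \<le> (LINT x|\<mu>. norm \<phi> * indicator (sym_diff A B) x)"
  proof (rule norm_integral_le_integral)
    show "integrable \<mu> (\<lambda>x. indicator A x *\<^sub>R \<phi> x - indicator B x *\<^sub>R \<phi> x)"
      using int by (rule Bochner_Integration.integrable_diff)
    show "integrable \<mu> (\<lambda>x. norm \<phi> * indicator (sym_diff A B) x)"
      using D fin by (intro integrable_mult_right) simp
    show "cmod (indicator A x *\<^sub>R \<phi> x - indicator B x *\<^sub>R \<phi> x)
        \<le> norm \<phi> * indicator (sym_diff A B) x" for x
      using norm_bcontfun_bound[of \<phi> x] by (auto simp: indicator_def)
  qed
  also have "\<dots> = norm \<phi> * measure \<mu> (sym_diff A B)"
    using D by (simp add: Int_absorb2 sets.sets_into_space)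
  finally show ?thesis .
qed

section \<open>Averages over sets of finite measure\<close>

lemma folner_average_translate: "folner_average \<mu> A (translate a f) g = folner_average \<mu> A f (g + a)"
  by (simp add: folner_average_def add.assoc)

context
  fixes \<mu> :: "'a::{topological_ab_group_add, t2_space} measure" and A :: "'a set"
  assumes haar: "haar_measure \<mu>" and borel: "A \<in> sets borel"
    and fin: "emeasure \<mu> A < \<infinity>" and pos: "measure \<mu> A > 0"
begin

lemma folner_set_integrable: "set_integrable \<mu> A (\<lambda>x. apply_bcontfun f (x + g) :: complex)"
  using set_integrable_bcontfun[OF haar borel fin, of "translate g f"]
  by (simp add: set_integrable_def)

lemma folner_average_add:
  "folner_average \<mu> A (f + h) g = folner_average \<mu> A f g + folner_average \<mu> A h g"
  by (simp only: folner_average_def plus_bcontfun.rep_eq distrib_left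
      set_integral_add(2)[OF folner_set_integrable folner_set_integrable])

lemma folner_average_cscale: "folner_average \<mu> A (cscale c f) g = c * folner_average \<mu> A f g"
  by (simp only: folner_average_def apply_cscale set_integral_mult_right mult.left_commute)

lemma folner_average_const: "folner_average \<mu> A (const_bcontfun c) g = c"
proof -
  have "A \<in> sets \<mu>" "emeasure \<mu> A \<noteq> \<infinity>"
    using borel fin by (simp_all add: haar_measure_sets[OF haar])
  then show ?thesis
    using pos by (simp add: folner_average_def set_integral_const scaleR_conv_of_real)
qed

lemma folner_average_dist_le:
  assumes "\<And>x. x \<in> A \<Longrightarrow> cmod (apply_bcontfun f (x + g) - apply_bcontfun h (x + g')) \<le> e"
  shows "cmod (folner_average \<mu> A f g - folner_average \<mu> A h g') \<le> e"
proof -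
  have "cmod ((LINT x:A|\<mu>. f (x + g)) - (LINT x:A|\<mu>. h (x + g'))) =
      cmod (LINT x:A|\<mu>. f (x + g) - h (x + g'))"
    by (simp only: set_integral_diff(2)[OF folner_set_integrable folner_set_integrable])
  also have "\<dots> \<le> e * measure \<mu> A"
    by (intro set_integral_norm_le_measure set_integral_diff(1) folner_set_integrable fin assms)
      (simp_all add: borel haar_measure_sets[OF haar])
  finally show ?thesis
    using pos by (simp add: folner_average_def norm_divide divide_le_eq flip: diff_divide_distrib)
qed

lemma folner_average_asymptotic_invariance:
  "cmod (folner_average \<mu> A f (g + a) - folner_average \<mu> A f g)
     \<le> norm f * (measure \<mu> (sym_diff A ((\<lambda>x. x + a) ` A)) / measure \<mu> A)"
proof -
  let ?\<phi> = "translate g f" and ?B = "(\<lambda>x. x + a) ` A"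
  have "norm ?\<phi> \<le> norm f"
    unfolding norm_bcontfun_def[of ?\<phi>]
    by (rule dist_bound) (use norm_bcontfun_bound in auto)
  have "(LINT x:A|\<mu>. f (x + (g + a))) = (LINT x:A|\<mu>. ?\<phi> (x + a))"
    by (simp add: ac_simps)
  also have "\<dots> = (LINT x:?B|\<mu>. ?\<phi> x)"
    by (rule set_integral_translate[OF haar borel])
  finally have "cmod ((LINT x:A|\<mu>. f (x + (g + a))) - (LINT x:A|\<mu>. f (x + g))) =
      cmod ((LINT x:A|\<mu>. ?\<phi> x) - (LINT x:?B|\<mu>. ?\<phi> x))"
    by (simp add: norm_minus_commute)
  also have "\<dots> \<le> norm ?\<phi> * measure \<mu> (sym_diff A ?B)"
    using haar_measure_translate[OF haar borel] fin
    by (intro set_integral_diff_le_sym_diff haar borel sets_borel_translate) auto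
  also have "\<dots> \<le> norm f * measure \<mu> (sym_diff A ?B)"
    using \<open>norm ?\<phi> \<le> norm f\<close> by (intro mult_right_mono) auto
  finally show ?thesis
    using pos by (simp add: folner_average_def norm_divide divide_right_mono flip: diff_divide_distrib)
qed

text \<open>
  The average is compared with the convex combination of the translates by a finite net
  \<open>a\<^sub>0, a\<^sub>1, \<dots>\<close>, weighted by the relative measures of disjoint pieces of \<open>A\<close>. The set of all
  \<open>x\<close> for which \<open>f(\<cdot> + x)\<close> is uniformly within \<open>e\<close> of \<open>f(\<cdot> + a\<^sub>i)\<close> is closed, being an
  intersection of closed conditions over all arguments. So the pieces are Borel sets, without
  appeal to uniform continuity of \<open>f\<close>.
\<close>

lemma folner_average_convex_approx:
  assumes "f \<in> AP" "0 < e"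
  obtains k :: nat and w a where "\<forall>i<k. 0 \<le> w i" "(\<Sum>i<k. w i) = (1::real)"
    "\<And>g. cmod ((\<Sum>i<k. complex_of_real (w i) * apply_bcontfun f (g + a i))
            - folner_average \<mu> A f g) \<le> e"
proof -
  obtain S where S: "finite S" "\<And>g. \<exists>s\<in>S. \<forall>y. cmod (f (y + g) - f (y + s)) \<le> e"
    using AP_totally_bounded[OF assms] by blast
  obtain a and k :: nat where a: "S = a ` {i. i < k}"
    using finite_imp_nat_seg_image_inj_on[OF S(1)] by blast
  define C where "C i = {x. \<forall>y. cmod (f (y + x) - f (y + a i)) \<le> e}" for i
  define D where "D i = A \<inter> disjointed C i" for i
  note sets = haar_measure_sets[OF haar]
  have "continuous_on UNIV (\<lambda>x. f (y + x))" for y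
    by (rule continuous_on_compose2[where g = "apply_bcontfun f" and t = UNIV])
      (auto intro!: continuous_intros)
  then have "closed (C i)" for i
    unfolding C_def by (intro closed_Collect_all closed_Collect_le continuous_intros)
  then have C: "range C \<subseteq> sets borel"
    by auto
  have D: "D i \<in> sets \<mu>" for i
    using sets.range_disjointed_sets[OF C] borel by (auto simp: D_def sets)
  have Dfin: "emeasure \<mu> (D i) < \<infinity>" for i
    using emeasure_mono[of "D i" A \<mu>] fin borel by (auto simp: D_def sets)
  have disj: "disjoint_family_on D {..<k}"
    using disjoint_family_disjointed[of C] by (fastforce simp: disjoint_family_on_def D_def)
  have "(\<Union>i<k. C i) = UNIV"
    using S(2) by (fastforce simp: a C_def)
  then have A: "(\<Union>i<k. D i) = A"
    using finite_UN_disjointed_eq[of C k] by (auto simp: D_def atLeast0LessThan)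
  define w where "w i = measure \<mu> (D i) / measure \<mu> A" for i
  have "(\<Sum>i<k. measure \<mu> (D i)) = measure \<mu> (\<Union>i<k. D i)"
    using D Dfin disj by (intro measure_finite_Union[symmetric]) (auto simp: less_top[symmetric])
  then have w1: "(\<Sum>i<k. w i) = 1"
    using pos by (simp add: w_def A flip: sum_divide_distrib)
  have w0: "\<forall>i<k. 0 \<le> w i"
    by (simp add: w_def)
  have "cmod ((\<Sum>i<k. complex_of_real (w i) * f (g + a i)) - folner_average \<mu> A f g) \<le> e" for g
  proof -
    have int: "set_integrable \<mu> (D i) (\<lambda>x. f (x + h))" for i h
      by (rule set_integrable_subset[OF folner_set_integrable D]) (auto simp: D_def)
    have intc: "set_integrable \<mu> (D i) (\<lambda>x. c)" for i and c :: complex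
      using D[of i] Dfin[of i] by (simp add: set_integrable_def)
    have "(LINT x:A|\<mu>. f (x + g)) = (\<Sum>i<k. LINT x:D i|\<mu>. f (x + g))"
      using set_integral_finite_Union[of "{..<k}" D \<mu> "\<lambda>x. f (x + g)"] disj D int A by simp
    then have "(\<Sum>i<k. complex_of_real (measure \<mu> (D i)) * f (g + a i)) - (LINT x:A|\<mu>. f (x + g)) =
        (\<Sum>i<k. (LINT x:D i|\<mu>. f (g + a i) - f (x + g)))"
      using D Dfin
      by (simp add: set_integral_diff(2)[OF intc int] set_integral_const sum_subtractf
          scaleR_conv_of_real less_top)
    also have "cmod \<dots> \<le> (\<Sum>i<k. e * measure \<mu> (D i))"
    proof (intro sum_norm_le set_integral_norm_le_measure D Dfin set_integral_diff(1) intc int)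
      fix i x assume "x \<in> D i"
      then have "x \<in> C i"
        using disjointed_subset[of C i] by (auto simp: D_def)
      then show "cmod (f (g + a i) - f (x + g)) \<le> e"
        by (simp add: C_def norm_minus_commute add.commute[of x g])
    qed
    also have "\<dots> = e * measure \<mu> A"
      using \<open>(\<Sum>i<k. measure \<mu> (D i)) = measure \<mu> (\<Union>i<k. D i)\<close> by (simp add: A flip: sum_distrib_left)
    finally have *: "cmod ((\<Sum>i<k. complex_of_real (measure \<mu> (D i)) * f (g + a i))
        - (LINT x:A|\<mu>. f (x + g))) \<le> e * measure \<mu> A" .
    have "(\<Sum>i<k. complex_of_real (w i) * f (g + a i)) - folner_average \<mu> A f g =
        ((\<Sum>i<k. complex_of_real (measure \<mu> (D i)) * f (g + a i)) - (LINT x:A|\<mu>. f (x + g)))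
          / complex_of_real (measure \<mu> A)"
      by (simp add: w_def folner_average_def diff_divide_distrib sum_divide_distrib)
    then show ?thesis
      using * pos by (simp add: norm_divide divide_le_eq)
  qed
  then show ?thesis
    using that[OF w0 w1] by blast
qed

end

section \<open>Averages along a Foelner sequence\<close>

lemma folner_seq_set:
  fixes F :: "nat \<Rightarrow> 'a::{topological_ab_group_add, t2_space} set"
  assumes "haar_measure \<mu>" "folner_seq \<mu> F"
  shows "F n \<in> sets borel" "emeasure \<mu> (F n) < \<infinity>" "measure \<mu> (F n) > 0"
  using assms haar_measure_compact[OF assms(1)]
  by (auto simp: folner_seq_def borel_compact)

context
  fixes \<mu> :: "'a::{topological_ab_group_add, t2_space} measure"
  assumes haar: "haar_measure \<mu>"
begin

lemma folner_average_nearly_constant: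
  assumes F: "folner_seq \<mu> F" and f: "f \<in> AP" and "0 < e"
  shows "\<forall>\<^sub>F n in sequentially. \<forall>g.
    cmod (folner_average \<mu> (F n) f g - folner_average \<mu> (F n) f 0) \<le> e"
proof -
  obtain S where S: "finite S" "\<And>g. \<exists>s\<in>S. \<forall>y. cmod (f (y + g) - f (y + s)) \<le> e / 2"
    using AP_totally_bounded[OF f, of "e / 2"] \<open>0 < e\<close> by auto
  note Fn = haar folner_seq_set[OF haar F]
  have "\<forall>\<^sub>F n in sequentially.
      cmod (folner_average \<mu> (F n) f s - folner_average \<mu> (F n) f 0) < e / 2" for s
  proof -
    let ?q = "\<lambda>n. measure \<mu> (sym_diff (F n) ((\<lambda>x. x + s) ` F n)) / measure \<mu> (F n)"
    have "?q \<longlonglongrightarrow> 0"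
      using F by (auto simp: folner_seq_def)
    then have "(\<lambda>n. norm f * ?q n) \<longlonglongrightarrow> 0"
      by (rule tendsto_mult_right_zero)
    then have "\<forall>\<^sub>F n in sequentially. norm f * ?q n < e / 2"
      by (rule order_tendstoD(2)) (use \<open>0 < e\<close> in simp)
    then show ?thesis
    proof eventually_elim
      case (elim n)
      then show ?case
        using folner_average_asymptotic_invariance[OF Fn, of n f 0 s]
        by (simp only: add_0_left)
    qed
  qed
  then have "\<forall>\<^sub>F n in sequentially. \<forall>s\<in>S.
      cmod (folner_average \<mu> (F n) f s - folner_average \<mu> (F n) f 0) < e / 2"
    using S(1) by (simp add: eventually_ball_finite)
  then show ?thesis
  proof eventually_elim
    case (elim n)
    show ?case
    proof
      fix g
      obtain s where s: "s \<in> S" "\<And>y. cmod (f (y + g) - f (y + s)) \<le> e / 2"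
        using S(2) by blast
      have "cmod (folner_average \<mu> (F n) f g - folner_average \<mu> (F n) f s) \<le> e / 2"
        by (rule folner_average_dist_le[OF Fn s(2)])
      moreover have "cmod (folner_average \<mu> (F n) f s - folner_average \<mu> (F n) f 0) \<le> e / 2"
        using elim s(1) by (simp add: less_imp_le)
      ultimately show "cmod (folner_average \<mu> (F n) f g - folner_average \<mu> (F n) f 0) \<le> e"
        using norm_diff_triangle_le by fastforce
    qed
  qed
qed

lemma averages_to_folner_average:
  assumes F: "folner_seq \<mu> F" and f: "f \<in> AP" and "0 < e"
  shows "\<forall>\<^sub>F n in sequentially. averages_to f (folner_average \<mu> (F n) f 0) e"
proof -
  have "\<forall>\<^sub>F n in sequentially. \<forall>g.
      cmod (folner_average \<mu> (F n) f g - folner_average \<mu> (F n) f 0) \<le> e / 2"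
    by (rule folner_average_nearly_constant[OF F f]) (use \<open>0 < e\<close> in simp)
  then show ?thesis
  proof eventually_elim
    case (elim n)
    obtain k :: nat and w a where w: "\<forall>i<k. 0 \<le> w i" "(\<Sum>i<k. w i) = (1::real)"
      "\<And>g. cmod ((\<Sum>i<k. complex_of_real (w i) * f (g + a i))
              - folner_average \<mu> (F n) f g) \<le> e / 2"
      using folner_average_convex_approx[OF haar folner_seq_set[OF haar F] f, of "e / 2" n] \<open>0 < e\<close>
      by auto
    have "cmod ((\<Sum>i<k. complex_of_real (w i) * f (y + a i)) - folner_average \<mu> (F n) f 0) \<le> e" for y
      using norm_diff_triangle_le[OF w(3)[of y] elim[rule_format, of y]] by simp
    then show ?case
      unfolding averages_to_def using w(1,2) by blast
  qed
qed

lemma folner_average_uniform_limit: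
  assumes c: "\<And>e. 0 < e \<Longrightarrow> averages_to (apply_bcontfun f) c e" and F: "folner_seq \<mu> F" and f: "f \<in> AP"
  shows "uniform_limit UNIV (\<lambda>n g. folner_average \<mu> (F n) f g) (\<lambda>g. c) sequentially"
proof (rule uniform_limitI)
  fix e :: real assume "0 < e"
  then have e: "0 < e / 4" by simp
  show "\<forall>\<^sub>F n in sequentially. \<forall>g\<in>UNIV. dist (folner_average \<mu> (F n) f g) c < e"
    using averages_to_folner_average[OF F f e] folner_average_nearly_constant[OF F f e]
  proof eventually_elim
    case (elim n)
    have "dist (folner_average \<mu> (F n) f g) c < e" for g
    proof -
      have "dist (folner_average \<mu> (F n) f 0) c \<le> e / 4 + e / 4"
        using averages_to_unique[OF elim(1) c[OF e]] by (simp add: dist_norm)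
      moreover have "dist (folner_average \<mu> (F n) f g) (folner_average \<mu> (F n) f 0) \<le> e / 4"
        using elim(2) by (simp add: dist_norm)
      ultimately show ?thesis
        using dist_triangle[of "folner_average \<mu> (F n) f g" c "folner_average \<mu> (F n) f 0"] \<open>0 < e\<close>
        by linarith
    qed
    then show ?case by blast
  qed
qed

lemma ex_averages_to:
  fixes f :: "'a \<Rightarrow>\<^sub>C complex"
  assumes F: "folner_seq \<mu> F" and f: "f \<in> AP"
  obtains c :: complex where "\<And>e. 0 < e \<Longrightarrow> averages_to (apply_bcontfun f) c e"
proof -
  let ?A = "\<lambda>n. folner_average \<mu> (F n) f 0"
  have "Cauchy ?A"
  proof (rule metric_CauchyI)
    fix e :: real assume "0 < e"
    then obtain N where N: "\<And>n. n \<ge> N \<Longrightarrow> averages_to f (?A n) (e / 3)"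
      using averages_to_folner_average[OF F f, of "e / 3"] by (auto simp: eventually_sequentially)
    have "dist (?A m) (?A n) < e" if "m \<ge> N" "n \<ge> N" for m n
      using averages_to_unique[OF N[OF that(1)] N[OF that(2)]] \<open>0 < e\<close> by (simp add: dist_norm)
    then show "\<exists>M. \<forall>m\<ge>M. \<forall>n\<ge>M. dist (?A m) (?A n) < e"
      by blast
  qed
  then obtain c where c: "?A \<longlonglongrightarrow> c"
    using Cauchy_convergent convergent_def by blast
  have "averages_to f c e" if "0 < e" for e
  proof -
    have e: "0 < e / 2" using that by simp
    have "\<forall>\<^sub>F n in sequentially. averages_to f (?A n) (e / 2) \<and> dist (?A n) c < e / 2"
      using averages_to_folner_average[OF F f e] tendstoD[OF c e] by (rule eventually_conj)
    then obtain n where n: "averages_to f (?A n) (e / 2)" "dist (?A n) c < e / 2"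
      using eventually_happens'[OF sequentially_bot] by blast
    from n(1) obtain k w a where w: "\<forall>i<k. 0 \<le> w i" "(\<Sum>i<(k::nat). w i) = (1::real)"
      "\<And>y. cmod ((\<Sum>i<k. complex_of_real (w i) * f (y + a i)) - ?A n) \<le> e / 2"
      unfolding averages_to_def by blast
    have "cmod (?A n - c) \<le> e / 2"
      using n(2) by (simp add: dist_norm)
    from norm_diff_triangle_le[OF w(3) this]
    have "cmod ((\<Sum>i<k. complex_of_real (w i) * f (y + a i)) - c) \<le> e" for y
      by simp
    then show ?thesis
      unfolding averages_to_def using w(1,2) by blast
  qed
  then show ?thesis using that by blast
qed

end

section \<open>The Bohr mean\<close>

lemma is_bohr_mean_sum:
  assumes M: "is_bohr_mean M" and h: "\<And>i. i \<in> I \<Longrightarrow> h i \<in> AP" and "finite I"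
  shows "M (\<Sum>i\<in>I. h i) = (\<Sum>i\<in>I. M (h i))"
  using \<open>finite I\<close> h
proof (induction I)
  case empty
  have "cscale 0 (const_bcontfun 1) = (0 :: 'a \<Rightarrow>\<^sub>C complex)"
    by (rule bcontfun_eqI) simp
  then show ?case
    using M AP_const unfolding is_bohr_mean_def by (metis mult_zero_left sum.empty)
next
  case (insert i I)
  then show ?case
    using M by (simp add: is_bohr_mean_def AP_sum)
qed

lemma is_bohr_mean_const:
  assumes "is_bohr_mean M"
  shows "M (const_bcontfun c) = c"
proof -
  have "const_bcontfun c = cscale c (const_bcontfun 1)"
    by (rule bcontfun_eqI) simp
  then show ?thesis
    using assms AP_const unfolding is_bohr_mean_def by (metis mult.right_neutral)
qed

text \<open>
  A Bohr mean is constant on the convex combinations of translates of \<open>f\<close>, and some sequence of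
  these converges uniformly to \<open>c\<close>.
\<close>

lemma is_bohr_mean_value:
  assumes M: "is_bohr_mean M" and f: "f \<in> AP" and c: "\<And>e. 0 < e \<Longrightarrow> averages_to (apply_bcontfun f) c e"
  shows "M f = c"
proof -
  have "\<exists>h. h \<in> AP \<and> M h = M f \<and> dist h (const_bcontfun c) \<le> e" if "0 < e" for e
  proof -
    obtain k w a where w: "(\<Sum>i<(k::nat). w i) = (1::real)"
      "\<And>y. cmod ((\<Sum>i<k. complex_of_real (w i) * f (y + a i)) - c) \<le> e"
      using c[OF \<open>0 < e\<close>] unfolding averages_to_def by blast
    define h where "h = (\<Sum>i<k. cscale (complex_of_real (w i)) (translate (a i) f))"
    have "apply_bcontfun (sum u I) x = (\<Sum>i\<in>I. u i x)" for u :: "nat \<Rightarrow> 'a \<Rightarrow>\<^sub>C complex" and I x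
      by (induction I rule: infinite_finite_induct) auto
    then have "dist h (const_bcontfun c) \<le> e"
      using w(2) by (intro dist_bound) (simp add: h_def dist_norm)
    moreover have "h \<in> AP"
      unfolding h_def by (intro AP_sum AP_cscale AP_translate f)
    moreover have "M h = M f"
    proof -
      have "M h = (\<Sum>i<k. M (cscale (complex_of_real (w i)) (translate (a i) f)))"
        unfolding h_def by (intro is_bohr_mean_sum M AP_cscale AP_translate f) auto
      also have "\<dots> = (\<Sum>i<k. complex_of_real (w i) * M f)"
        using M f AP_translate[OF f] by (intro sum.cong refl) (simp add: is_bohr_mean_def)
      also have "\<dots> = M f"
        using w(1) by (simp flip: sum_distrib_right of_real_sum)
      finally show ?thesis .
    qed
    ultimately show ?thesis by blast
  qed
  then have "\<forall>n. \<exists>h. h \<in> AP \<and> M h = M f \<and> dist h (const_bcontfun c) \<le> inverse (real (Suc n))"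
    by simp
  then obtain h where h: "\<And>n. h n \<in> AP" "\<And>n. M (h n) = M f"
    "\<And>n. dist (h n) (const_bcontfun c) \<le> inverse (real (Suc n))"
    by metis
  have "(\<lambda>n. dist (h n) (const_bcontfun c)) \<longlonglongrightarrow> 0"
    by (rule tendsto_sandwich[OF _ _ tendsto_const LIMSEQ_inverse_real_of_nat]) (use h(3) in auto)
  then have "h \<longlonglongrightarrow> const_bcontfun c"
    by (rule iffD2[OF tendsto_dist_iff])
  moreover have "continuous_on AP M"
    using M by (simp add: is_bohr_mean_def)
  ultimately have "(\<lambda>n. M (h n)) \<longlonglongrightarrow> M (const_bcontfun c)"
    by (intro continuous_on_tendsto_compose[of AP M h]) (simp_all add: h(1) AP_const)
  then have "(\<lambda>n::nat. M f) \<longlonglongrightarrow> c"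
    by (simp add: h(2) is_bohr_mean_const[OF M])
  then show ?thesis
    by (simp add: LIMSEQ_const_iff)
qed

lemma ex_is_bohr_mean:
  fixes \<mu> :: "'a::{topological_ab_group_add, t2_space} measure"
  assumes haar: "haar_measure \<mu>" and F: "folner_seq \<mu> F"
  shows "\<exists>M. is_bohr_mean (M :: ('a \<Rightarrow>\<^sub>C complex) \<Rightarrow> complex)"
proof -
  note Fn = haar folner_seq_set[OF haar F]
  let ?A = "\<lambda>n. folner_average \<mu> (F n)"
  define M where "M = restrict (\<lambda>f. lim (\<lambda>n. ?A n f 0)) AP"
  have lim: "(\<lambda>n. ?A n f g) \<longlonglongrightarrow> M f" if f: "f \<in> AP" for f g
  proof -
    obtain c where "\<And>e. 0 < e \<Longrightarrow> averages_to f c e"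
      using ex_averages_to[OF haar F f] by blast
    then have "uniform_limit UNIV (\<lambda>n g. ?A n f g) (\<lambda>g. c) sequentially"
      by (intro folner_average_uniform_limit[OF haar _ F f])
    then have c: "(\<lambda>n. ?A n f g) \<longlonglongrightarrow> c" for g
      by (rule tendsto_uniform_limitI) simp
    then have "M f = c"
      using f by (simp add: M_def limI)
    then show ?thesis
      using c by simp
  qed
  have eq: "M f = c" if "(\<lambda>n. ?A n f 0) \<longlonglongrightarrow> c" "f \<in> AP" for f c
    using LIMSEQ_unique[OF that(1) lim[OF that(2)]] by simp
  have "M \<in> extensional AP"
    by (simp add: M_def)
  moreover have "M (f + h) = M f + M h" if "f \<in> AP" "h \<in> AP" for f h
    using tendsto_add[OF lim[OF that(1), of 0] lim[OF that(2), of 0]] that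
    by (intro eq) (simp_all add: folner_average_add[OF Fn] AP_add)
  moreover have "M (cscale c f) = c * M f" if "f \<in> AP" for c f
    using tendsto_mult_left[OF lim[OF that, of 0], of c] that
    by (intro eq) (simp_all add: folner_average_cscale[OF Fn] AP_cscale)
  moreover have "continuous_on AP M"
  proof -
    have "dist (M f) (M h) \<le> dist f h" if f: "f \<in> AP" and h: "h \<in> AP" for f h
    proof (rule tendsto_upperbound)
      show "(\<lambda>n. dist (?A n f 0) (?A n h 0)) \<longlonglongrightarrow> dist (M f) (M h)"
        by (intro tendsto_dist lim f h)
      have "dist (?A n f 0) (?A n h 0) \<le> dist f h" for n
        using folner_average_dist_le[OF Fn, of n f 0 h 0 "dist f h"] dist_bounded[of f _ h]
        by (simp add: dist_norm)
      then show "\<forall>\<^sub>F n in sequentially. dist (?A n f 0) (?A n h 0) \<le> dist f h"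
        by simp
    qed simp
    then have "1-lipschitz_on AP M"
      by (intro lipschitz_onI) auto
    then show ?thesis
      by (rule lipschitz_on_continuous_on)
  qed
  moreover have "M (translate g f) = M f" if "f \<in> AP" for g f
    using lim[OF that, of g] that
    by (intro eq) (simp_all add: folner_average_translate AP_translate)
  moreover have "M (const_bcontfun 1) = 1"
    by (intro eq) (simp_all add: folner_average_const[OF Fn] AP_const)
  ultimately have "is_bohr_mean M"
    by (simp add: is_bohr_mean_def)
  then show ?thesis by blast
qed

lemma bohr_mean_eq:
  fixes \<mu> :: "'a::{topological_ab_group_add, t2_space} measure"
    and f :: "'a \<Rightarrow>\<^sub>C complex"
  assumes haar: "haar_measure \<mu>" and F: "folner_seq \<mu> F"
    and f: "f \<in> AP" and c: "\<And>e. 0 < e \<Longrightarrow> averages_to (apply_bcontfun f) c e"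
  shows "bohr_mean f = c"
proof -
  have "M = M'" if M: "is_bohr_mean M" and M': "is_bohr_mean M'"
    for M M' :: "('a \<Rightarrow>\<^sub>C complex) \<Rightarrow> complex"
  proof (rule extensionalityI)
    show "M \<in> extensional AP" "M' \<in> extensional AP"
      using M M' by (auto simp: is_bohr_mean_def)
    fix h :: "'a \<Rightarrow>\<^sub>C complex" assume h: "h \<in> AP"
    obtain d where d: "\<And>e. 0 < e \<Longrightarrow> averages_to h d e"
      using ex_averages_to[OF haar F h] by blast
    have "M h = d" "M' h = d"
      using is_bohr_mean_value[OF M h] is_bohr_mean_value[OF M' h] d by blast+
    then show "M h = M' h"
      by simp
  qed
  then have "is_bohr_mean (bohr_mean :: ('a \<Rightarrow>\<^sub>C complex) \<Rightarrow> complex)"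
    unfolding bohr_mean_def using ex_is_bohr_mean[OF haar F] by (metis theI)
  then show ?thesis
    by (rule is_bohr_mean_value) (fact f, fact c)
qed

theorem theorem1p6:
  fixes \<mu> :: "'a::{topological_ab_group_add, t2_space} measure"
    and f :: "'a \<Rightarrow>\<^sub>C complex"
  assumes "locally_compact_space (euclidean :: 'a topology)"
    and "haar_measure \<mu>"
    and "f \<in> AP"
  shows
    "(\<forall>F. folner_seq \<mu> F \<longrightarrow>
        (\<forall>g. (\<lambda>n. folner_average \<mu> (F n) f g) \<longlonglongrightarrow> bohr_mean f))
     \<and> (\<forall>F F'. folner_seq \<mu> F \<longrightarrow> folner_seq \<mu> F' \<longrightarrow>
        (\<forall>g. lim (\<lambda>n. folner_average \<mu> (F n) f g) = lim (\<lambda>n. folner_average \<mu> (F' n) f g)))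
     \<and> (\<forall>F. folner_seq \<mu> F \<longrightarrow>
        uniform_limit UNIV (\<lambda>n g. folner_average \<mu> (F n) f g) (\<lambda>g. bohr_mean f) sequentially)"
proof -
  have unif: "uniform_limit UNIV (\<lambda>n g. folner_average \<mu> (F n) f g) (\<lambda>g. bohr_mean f) sequentially"
    if F: "folner_seq \<mu> F" for F
  proof -
    obtain c where c: "\<And>e. 0 < e \<Longrightarrow> averages_to f c e"
      using ex_averages_to[OF assms(2) F assms(3)] by blast
    have "bohr_mean f = c"
      by (rule bohr_mean_eq[OF assms(2) F assms(3)]) (fact c)
    then show ?thesis
      using folner_average_uniform_limit[OF assms(2) _ F assms(3)] c by simp
  qed
  then have lim: "(\<lambda>n. folner_average \<mu> (F n) f g) \<longlonglongrightarrow> bohr_mean f" if "folner_seq \<mu> F" for F g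
    using tendsto_uniform_limitI[OF unif[OF that]] by simp
  have "lim (\<lambda>n. folner_average \<mu> (F n) f g) = lim (\<lambda>n. folner_average \<mu> (F' n) f g)"
    if "folner_seq \<mu> F" "folner_seq \<mu> F'" for F F' g
    using limI[OF lim[OF that(1)]] limI[OF lim[OF that(2)]] by simp
  then show ?thesis
    using unif lim by blast
qed

end
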